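(* $sat(K_3^2,C_5)=6$, and $sat(K_3^n,C_5)=3n+1$ for every $n\ge 3$.
   Context: All graphs are finite, simple and undirected. $K_k^n$ denotes the complete $k$-partite graph with exactly $n$ vertices in each of its $k$ parts. $C_5$ is the cycle on $5$ vertices. For graphs $G$ and $F$, a spanning subgraph $H$ of $G$ is $F$-saturated relative to $G$ if $H$ contains no copy of $F$ but $H+e$ contains a copy of $F$ for every $e\in E(G)\setminus E(H)$; $sat(G,F)$ is the minimum number of edges of a graph that is $F$-saturated relative to $G$. *)

theory Defs
  imports Main
begin

record 'a sgraph =
  verts :: "'a set"
  edges :: "'a set set"

definition simple_graph :: "'a sgraph \<Rightarrow> bool" where
  "simple_graph G \<longleftrightarrow>
     finite (verts G) \<and> (\<forall>e \<in> edges G. e \<subseteq> verts G \<and> card e = 2)"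

definition subgraph :: "'a sgraph \<Rightarrow> 'a sgraph \<Rightarrow> bool" where
  "subgraph H G \<longleftrightarrow> simple_graph H \<and> verts H \<subseteq> verts G \<and> edges H \<subseteq> edges G"

definition spanning_subgraph :: "'a sgraph \<Rightarrow> 'a sgraph \<Rightarrow> bool" where
  "spanning_subgraph H G \<longleftrightarrow> subgraph H G \<and> verts H = verts G"

definition isomorphic :: "'a sgraph \<Rightarrow> 'b sgraph \<Rightarrow> bool" where
  "isomorphic G H \<longleftrightarrow>
     (\<exists>f. bij_betw f (verts G) (verts H) \<and> edges H = (\<lambda>e. f ` e) ` edges G)"

(* A copy of F is a subgraph isomorphic to F; it need not be induced. *)
definition contains_copy :: "'a sgraph \<Rightarrow> 'b sgraph \<Rightarrow> bool" where
  "contains_copy G F \<longleftrightarrow> (\<exists>H. subgraph H G \<and> isomorphic F H)"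

definition add_edge :: "'a sgraph \<Rightarrow> 'a set \<Rightarrow> 'a sgraph" where
  "add_edge G e = G\<lparr>edges := insert e (edges G)\<rparr>"

definition saturated :: "'a sgraph \<Rightarrow> 'b sgraph \<Rightarrow> 'a sgraph \<Rightarrow> bool" where
  "saturated G F H \<longleftrightarrow>
     spanning_subgraph H G \<and> \<not> contains_copy H F \<and>
     (\<forall>e \<in> edges G - edges H. contains_copy (add_edge H e) F)"

(* Inf on nat is the minimum of a nonempty set; Inf {} = 0. If F has an edge and G is a
   simple graph, then some H is saturated, so the set below is nonempty. *)
definition sat_number :: "'a sgraph \<Rightarrow> 'b sgraph \<Rightarrow> nat" where
  "sat_number G F = Inf {card (edges H) | H. saturated G F H}"

(* The vertex (i, a) is the a-th vertex of the i-th part. *)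
definition complete_multipartite :: "nat \<Rightarrow> nat \<Rightarrow> (nat \<times> nat) sgraph" where
  "complete_multipartite k n =
     \<lparr>verts = {..<k} \<times> {..<n},
      edges = {{(i, a), (j, b)} | i a j b. i < k \<and> j < k \<and> i \<noteq> j \<and> a < n \<and> b < n}\<rparr>"

(* Only meaningful for m at least 3: smaller m would give loops or a single edge. *)
definition cycle_graph :: "nat \<Rightarrow> nat sgraph" where
  "cycle_graph m =
     \<lparr>verts = {..<m}, edges = {{i, (i + 1) mod m} | i. i < m}\<rparr>"

lemma simple_graph_complete_multipartite: "simple_graph (complete_multipartite k n)"
  by (auto simp: simple_graph_def complete_multipartite_def card_2_iff)

lemma simple_graph_cycle_graph:
  assumes "m \<ge> 3"
  shows "simple_graph (cycle_graph m)"
proof -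
  have "i \<noteq> (i + 1) mod m" if "i < m" for i
    using assms that by (cases "i + 1 = m") auto
  then show ?thesis
    using assms by (auto simp: simple_graph_def cycle_graph_def card_2_iff)
qed

end

theory Submission
  imports Defs
begin

text \<open>
  A spanning subgraph of a complete multipartite graph is \<open>C\<^sub>5\<close>-saturated iff it has no
  5-cycle and any two non-adjacent vertices in different parts are joined by a path with four edges.
  This survives the deletion of a leaf. With three parts it therefore suffices to look at graphs
  of minimum degree at least 2: such a graph has at least as many edges as vertices, with equality
  only if it is 2-regular, and no leaf can be attached to a 2-regular saturated graph. In the
  2-regular case a vertex has two neighbours and is the start of at most two paths with four edges,
  so at most four vertices lie outside its part; summing over the parts gives at most 6 vertices.
  A hexagon attains the bound for \<open>n = 2\<close>. For \<open>n \<ge> 3\<close>, take a 4-cycle with one chord, a pendant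
  vertex at one end of the missing chord, and leaves at that vertex and at both ends of the chord.
\<close>

section \<open>Paths with four edges and the reformulation of saturation\<close>

text \<open>An edge \<open>{u, v}\<close> closes such a path to a 5-cycle, so one predicate serves
  both \<open>C_5\<close>-freeness and the effect of adding a missing edge.\<close>

definition path4 :: "'a set set \<Rightarrow> 'a \<Rightarrow> 'a \<Rightarrow> bool" where
  "path4 E u v \<longleftrightarrow> (\<exists>x y z. distinct [u, x, y, z, v] \<and>
     {u, x} \<in> E \<and> {x, y} \<in> E \<and> {y, z} \<in> E \<and> {z, v} \<in> E)"

text \<open>The host graph enters only through a colouring \<open>c\<close> by parts and an
  arbitrary vertex set \<open>V\<close>. Parts may have different sizes, so the class is closed
  under deletion of leaves.\<close>

definition C5_saturated :: "('a \<Rightarrow> 'b) \<Rightarrow> 'a set \<Rightarrow> 'a set set \<Rightarrow> bool" where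
  "C5_saturated c V E \<longleftrightarrow> finite V \<and>
     (\<forall>e\<in>E. \<exists>u\<in>V. \<exists>v\<in>V. e = {u, v} \<and> c u \<noteq> c v) \<and>
     (\<forall>u v. {u, v} \<in> E \<longrightarrow> \<not> path4 E u v) \<and>
     (\<forall>u\<in>V. \<forall>v\<in>V. c u \<noteq> c v \<longrightarrow> {u, v} \<in> E \<or> path4 E u v)"

lemma path4I:
  assumes "distinct [u, x, y, z, v]" "{u, x} \<in> E" "{x, y} \<in> E" "{y, z} \<in> E" "{z, v} \<in> E"
  shows "path4 E u v"
  using assms unfolding path4_def by blast

lemma path4E:
  assumes "path4 E u v"
  obtains x y z where "distinct [u, x, y, z, v]"
    "{u, x} \<in> E" "{x, y} \<in> E" "{y, z} \<in> E" "{z, v} \<in> E"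
  using assms unfolding path4_def by blast

lemma path4_mono:
  assumes "path4 E u v" "E \<subseteq> F"
  shows "path4 F u v"
proof -
  obtain x y z where "distinct [u, x, y, z, v]"
    "{u, x} \<in> E" "{x, y} \<in> E" "{y, z} \<in> E" "{z, v} \<in> E"
    using assms(1) by (rule path4E)
  then show ?thesis
    using assms(2) by (intro path4I[of u x y z v]) auto
qed

lemma path4_sym: "path4 E u v \<Longrightarrow> path4 E v u"
proof -
  assume "path4 E u v"
  then obtain x y z where "distinct [u, x, y, z, v]"
    "{u, x} \<in> E" "{x, y} \<in> E" "{y, z} \<in> E" "{z, v} \<in> E"
    unfolding path4_def by blast
  then show ?thesis
    by (intro path4I[of v z y x u]) (auto simp: insert_commute)
qed

text \<open>A 5-cycle that appears with the new edge must use it. Rotating the cycle until the new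
  edge is the closing one leaves a four-edge path in \<open>E\<close>.\<close>

lemma path4_insert:
  assumes "{a, b} \<in> insert {u, v} E" "path4 (insert {u, v} E) a b"
    and free: "\<And>a b. {a, b} \<in> E \<Longrightarrow> \<not> path4 E a b"
  shows "path4 E u v"
proof -
  let ?E = "insert {u, v} E"
  have closing: "path4 E u v"
    if "{p, t} = {u, v}" "distinct [p, q, r, s, t]"
       "{p, q} \<in> ?E" "{q, r} \<in> ?E" "{r, s} \<in> ?E" "{s, t} \<in> ?E" for p q r s t
  proof -
    have "{p, q} \<noteq> {p, t}" "{q, r} \<noteq> {p, t}" "{r, s} \<noteq> {p, t}" "{s, t} \<noteq> {p, t}"
      using that(2) by (auto simp: doubleton_eq_iff)
    then have "path4 E p t"
      using that by (intro path4I[of p q r s t]) simp_all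
    then show ?thesis
      using that(1) by (auto simp: doubleton_eq_iff intro: path4_sym)
  qed
  obtain x y z where *: "distinct [a, x, y, z, b]"
    "{a, x} \<in> ?E" "{x, y} \<in> ?E" "{y, z} \<in> ?E" "{z, b} \<in> ?E"
    using assms(2) by (rule path4E)
  have rev: "{q, p} \<in> F" if "{p, q} \<in> F" for p q F
    using that by (simp only: insert_commute[of q p "{}"])
  show ?thesis
  proof (rule ccontr)
    assume not: "\<not> path4 E u v"
    \<comment> \<open>If no path joins \<open>u\<close> and \<open>v\<close> in \<open>E\<close>,
      the closing edge of any 5-cycle is old. Applying this to all five rotations puts the whole
      cycle into \<open>E\<close>, against \<open>free\<close>.\<close>
    have old: "{p, t} \<in> E" if "{p, t} \<in> ?E" "distinct [p, q, r, s, t]"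
      "{p, q} \<in> ?E" "{q, r} \<in> ?E" "{r, s} \<in> ?E" "{s, t} \<in> ?E" for p q r s t
    proof (rule insertE[OF that(1)])
      assume "{p, t} = {u, v}"
      then have "path4 E u v"
        using that(2-6) by (rule closing)
      then show ?thesis
        using not by contradiction
    qed
    have d: "distinct [x, y, z, b, a]" "distinct [y, z, b, a, x]" "distinct [z, b, a, x, y]"
      "distinct [b, a, x, y, z]"
      using *(1) by auto
    note e = *(2-5) rev[OF assms(1)]
    have "{a, b} \<in> E"
      using assms(1) *(1) e(1-4) by (rule old)
    moreover have "{a, x} \<in> E"
      using rev[OF e(1)] d(1) e(2-5) by (rule old[THEN rev])
    moreover have "{x, y} \<in> E"
      using rev[OF e(2)] d(2) e(3-5) e(1) by (rule old[THEN rev])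
    moreover have "{y, z} \<in> E"
      using rev[OF e(3)] d(3) e(4-5) e(1-2) by (rule old[THEN rev])
    moreover have "{z, b} \<in> E"
      using rev[OF e(4)] d(4) e(5) e(1-3) by (rule old[THEN rev])
    ultimately show False
      using free path4I[OF *(1)] by blast
  qed
qed

lemma edges_cycle_graph_5: "edges (cycle_graph 5) = {{0, 1}, {1, 2}, {2, 3}, {3, 4}, {4, 0}}"
proof -
  have "{{i, (i + 1) mod 5} | i. i < 5} = (\<lambda>i::nat. {i, (i + 1) mod 5}) ` {..<5}"
    by auto
  also have "{..<5} = {0, 1, 2, 3, 4 :: nat}"
    by auto
  finally show ?thesis
    by (simp add: cycle_graph_def numeral_2_eq_2)
qed

lemma contains_C5_iff:
  assumes "simple_graph G"
  shows "contains_copy G (cycle_graph 5) \<longleftrightarrow> (\<exists>u v. {u, v} \<in> edges G \<and> path4 (edges G) u v)"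
proof
  assume "contains_copy G (cycle_graph 5)"
  then obtain H where H: "subgraph H G" and iso: "isomorphic (cycle_graph 5) H"
    unfolding contains_copy_def by blast
  obtain f where f: "bij_betw f (verts (cycle_graph 5)) (verts H)"
    and E: "edges H = (\<lambda>e. f ` e) ` edges (cycle_graph 5)"
    using iso unfolding isomorphic_def by blast
  have inj: "inj_on f {..<5}"
    using f by (simp add: bij_betw_def cycle_graph_def)
  have "distinct (map f [0, 1, 2, 3, 4])"
    unfolding distinct_map by (intro conjI inj_on_subset[OF inj]) auto
  moreover have "{{f 0, f 1}, {f 1, f 2}, {f 2, f 3}, {f 3, f 4}, {f 4, f 0}} \<subseteq> edges G"
    using H unfolding subgraph_def E edges_cycle_graph_5 by simp
  ultimately have "{f 0, f 4} \<in> edges G" "path4 (edges G) (f 0) (f 4)"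
    by (auto intro!: path4I[of _ "f 1" "f 2" "f 3"] simp: insert_commute)
  then show "\<exists>u v. {u, v} \<in> edges G \<and> path4 (edges G) u v"
    by blast
next
  assume "\<exists>u v. {u, v} \<in> edges G \<and> path4 (edges G) u v"
  then obtain u v where uv: "{u, v} \<in> edges G" "path4 (edges G) u v"
    by blast
  obtain x y z where d: "distinct [u, x, y, z, v]"
    and e: "{u, x} \<in> edges G" "{x, y} \<in> edges G" "{y, z} \<in> edges G" "{z, v} \<in> edges G"
    using uv(2) by (rule path4E)
  have vu: "{v, u} \<in> edges G"
    using uv(1) by (simp add: insert_commute)
  \<comment> \<open>List indexing maps the vertices 0 to 4 of the standard cycle to the given cycle
    in order.\<close>
  define f where "f = (!) [u, x, y, z, v]"
  define H where "H = \<lparr>verts = {u, x, y, z, v}, edges = {{u, x}, {x, y}, {y, z}, {z, v}, {v, u}}\<rparr>"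
  have f: "f 0 = u" "f 1 = x" "f 2 = y" "f 3 = z" "f 4 = v"
    by (simp_all add: f_def)
  have "bij_betw f {..<5} {u, x, y, z, v}"
    unfolding f_def by (rule bij_betw_nth[OF d]) simp_all
  then have "bij_betw f (verts (cycle_graph 5)) (verts H)"
    by (simp add: H_def cycle_graph_def)
  moreover have "edges H = (\<lambda>e. f ` e) ` edges (cycle_graph 5)"
    unfolding edges_cycle_graph_5 using f by (simp add: H_def)
  moreover have "subgraph H G"
  proof -
    have "{a, b} \<subseteq> verts G" if "{a, b} \<in> edges G" for a b
      using assms that unfolding simple_graph_def by blast
    from this[OF e(1)] this[OF e(3)] this[OF vu] have "verts H \<subseteq> verts G"
      by (simp add: H_def)
    moreover have "simple_graph H"
      using d by (auto simp: simple_graph_def H_def)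
    ultimately show ?thesis
      using e vu by (simp add: subgraph_def H_def)
  qed
  ultimately show "contains_copy G (cycle_graph 5)"
    unfolding contains_copy_def isomorphic_def by blast
qed

lemma edges_complete_multipartite_iff:
  "e \<in> edges (complete_multipartite k n) \<longleftrightarrow>
     (\<exists>u \<in> {..<k} \<times> {..<n}. \<exists>v \<in> {..<k} \<times> {..<n}. e = {u, v} \<and> fst u \<noteq> fst v)"
  by (fastforce simp: complete_multipartite_def)

lemma saturated_complete_multipartite_C5_iff:
  "saturated (complete_multipartite k n) (cycle_graph 5) H \<longleftrightarrow>
     verts H = {..<k} \<times> {..<n} \<and> C5_saturated fst ({..<k} \<times> {..<n}) (edges H)"
  (is "saturated ?K ?C H \<longleftrightarrow> verts H = ?V \<and> C5_saturated fst ?V ?E")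
\<comment> \<open>Each side of the equivalence implies this condition, so only graphs
  \<open>H\<close> that span the host remain; such an \<open>H\<close> is simple, as
  \<open>contains_C5_iff\<close> requires.\<close>
proof (cases "verts H = ?V \<and> ?E \<subseteq> edges ?K")
  case True
  have K: "simple_graph ?K"
    by (rule simple_graph_complete_multipartite)
  have vK: "verts ?K = ?V"
    by (simp add: complete_multipartite_def)
  have simple: "simple_graph H"
    using True K vK unfolding simple_graph_def by auto
  then have span: "spanning_subgraph H ?K"
    using True vK unfolding spanning_subgraph_def subgraph_def by simp
  have add: "contains_copy (add_edge H {u, v}) ?C \<longleftrightarrow> path4 ?E u v"
    if "{u, v} \<in> edges ?K" "\<not> contains_copy H ?C" for u v
  proof -
    have "simple_graph (add_edge H {u, v})"
      using simple K vK that True unfolding simple_graph_def add_edge_def by auto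
    then have "contains_copy (add_edge H {u, v}) ?C \<longleftrightarrow>
        (\<exists>a b. {a, b} \<in> insert {u, v} ?E \<and> path4 (insert {u, v} ?E) a b)"
      by (simp add: contains_C5_iff add_edge_def)
    also have "\<dots> \<longleftrightarrow> path4 ?E u v"
    proof
      assume "\<exists>a b. {a, b} \<in> insert {u, v} ?E \<and> path4 (insert {u, v} ?E) a b"
      then show "path4 ?E u v"
        using path4_insert[of _ _ u v ?E] that(2) unfolding contains_C5_iff[OF simple] by blast
    next
      assume "path4 ?E u v"
      then have "path4 (insert {u, v} ?E) u v"
        by (rule path4_mono) auto
      then show "\<exists>a b. {a, b} \<in> insert {u, v} ?E \<and> path4 (insert {u, v} ?E) a b"
        by blast
    qed
    finally show ?thesis .
  qed
  have proper: "\<forall>e\<in>?E. \<exists>u\<in>?V. \<exists>v\<in>?V. e = {u, v} \<and> fst u \<noteq> fst v"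
    using True edges_complete_multipartite_iff by blast
  have sat: "(\<forall>e\<in>edges ?K - ?E. contains_copy (add_edge H e) ?C) \<longleftrightarrow>
      (\<forall>u\<in>?V. \<forall>v\<in>?V. fst u \<noteq> fst v \<longrightarrow> {u, v} \<in> ?E \<or> path4 ?E u v)"
    if free: "\<not> contains_copy H ?C"
  proof
    assume L: "\<forall>e\<in>edges ?K - ?E. contains_copy (add_edge H e) ?C"
    show "\<forall>u\<in>?V. \<forall>v\<in>?V. fst u \<noteq> fst v \<longrightarrow> {u, v} \<in> ?E \<or> path4 ?E u v"
    proof (intro ballI impI)
      fix u v assume "u \<in> ?V" "v \<in> ?V" "fst u \<noteq> fst v"
      then have "{u, v} \<in> edges ?K"
        using edges_complete_multipartite_iff by blast
      then show "{u, v} \<in> ?E \<or> path4 ?E u v"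
        using L add free by blast
    qed
  next
    assume R: "\<forall>u\<in>?V. \<forall>v\<in>?V. fst u \<noteq> fst v \<longrightarrow> {u, v} \<in> ?E \<or> path4 ?E u v"
    show "\<forall>e\<in>edges ?K - ?E. contains_copy (add_edge H e) ?C"
    proof
      fix e assume e: "e \<in> edges ?K - ?E"
      then obtain u v where "u \<in> ?V" "v \<in> ?V" "e = {u, v}" "fst u \<noteq> fst v"
        using edges_complete_multipartite_iff[of e k n] by blast
      then show "contains_copy (add_edge H e) ?C"
        using R e add[of u v] free by blast
    qed
  qed
  have free: "contains_copy H ?C \<longleftrightarrow> \<not> (\<forall>u v. {u, v} \<in> ?E \<longrightarrow> \<not> path4 ?E u v)"
    unfolding contains_C5_iff[OF simple] by blast
  have fin: "finite ?V"
    by simp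
  show ?thesis
  proof (cases "contains_copy H ?C")
    case True
    then show ?thesis
      using free unfolding saturated_def C5_saturated_def by blast
  next
    case False
    then show ?thesis
      using True span proper fin free sat[OF False] unfolding saturated_def C5_saturated_def by argo
  qed
next
  case False
  have "verts H = ?V \<and> ?E \<subseteq> edges ?K" if "saturated ?K ?C H"
    using that unfolding saturated_def spanning_subgraph_def subgraph_def
    by (simp add: complete_multipartite_def)
  moreover have "?E \<subseteq> edges ?K" if "C5_saturated fst ?V ?E"
    by (rule subsetI, unfold edges_complete_multipartite_iff)
      (use that in \<open>simp only: C5_saturated_def\<close>)
  ultimately show ?thesis
    using False by blast
qed

text \<open>An example with at most \<open>m\<close> edges suffices: the lower bound, applied to the
  example itself, turns this into equality.\<close>

lemma sat_number_complete_multipartite_C5_eq: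
  assumes "C5_saturated fst ({..<k} \<times> {..<n}) E" "card E \<le> m"
    and "\<And>E. C5_saturated fst ({..<k} \<times> {..<n}) E \<Longrightarrow> m \<le> card E"
  shows "sat_number (complete_multipartite k n) (cycle_graph 5) = m"
  unfolding sat_number_def
proof (rule cInf_eq_minimum)
  have "saturated (complete_multipartite k n) (cycle_graph 5)
      \<lparr>verts = {..<k} \<times> {..<n}, edges = E\<rparr>"
    using assms(1) by (simp add: saturated_complete_multipartite_C5_iff)
  moreover have "card E = m"
    using assms by (simp add: le_antisym)
  ultimately show "m \<in> {card (edges H) | H.
      saturated (complete_multipartite k n) (cycle_graph 5) H}"
    by (metis (mono_tags, lifting) CollectI sgraph.select_convs(2))
  show "m \<le> j" if "j \<in> {card (edges H) | H.
      saturated (complete_multipartite k n) (cycle_graph 5) H}" for j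
    using assms(3) that by (auto simp only: saturated_complete_multipartite_C5_iff mem_Collect_eq)
qed

section \<open>Neighbourhoods and degree sums\<close>

definition nbrs :: "'a set set \<Rightarrow> 'a \<Rightarrow> 'a set" where
  "nbrs E v = {w. {v, w} \<in> E}"

lemma C5_saturated_edge:
  assumes "C5_saturated c V E" "{u, v} \<in> E"
  shows "u \<in> V" "v \<in> V" "c u \<noteq> c v" "u \<noteq> v"
proof -
  have "\<exists>a\<in>V. \<exists>b\<in>V. {u, v} = {a, b} \<and> c a \<noteq> c b"
    using assms by (simp add: C5_saturated_def)
  then obtain a b where "a \<in> V" "b \<in> V" "{u, v} = {a, b}" "c a \<noteq> c b"
    by blast
  then show "u \<in> V" "v \<in> V" "c u \<noteq> c v" "u \<noteq> v"
    by (auto simp: doubleton_eq_iff)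
qed

lemma finite_nbrs: "C5_saturated c V E \<Longrightarrow> finite (nbrs E v)"
  by (rule finite_subset[of _ V]) (auto simp: nbrs_def dest: C5_saturated_edge(2), simp add: C5_saturated_def)

lemma finite_good_edges: "C5_saturated c V E \<Longrightarrow> finite E"
  by (rule finite_subset[of _ "Pow V"]) (auto simp: C5_saturated_def)

text \<open>Handshake identity: sending a neighbour \<open>w\<close> of \<open>v\<close> to
  \<open>{v, w}\<close> matches neighbours with incident edges, and every edge is incident to two
  vertices.\<close>

lemma sum_card_nbrs:
  assumes "C5_saturated c V E"
  shows "(\<Sum>v\<in>V. card (nbrs E v)) = 2 * card E"
proof -
  have fin: "finite V" "finite E"
    using assms finite_good_edges by (auto simp: C5_saturated_def)
  have "card (nbrs E v) = card {e \<in> E. v \<in> e}" for v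
  proof -
    have "\<exists>w. e = {v, w}" if "e \<in> E" "v \<in> e" for e
    proof -
      have "\<exists>u\<in>V. \<exists>w\<in>V. e = {u, w} \<and> c u \<noteq> c w"
        using assms that(1) by (simp add: C5_saturated_def)
      then show ?thesis
        using that(2) by (auto simp: insert_commute)
    qed
    then have "{e \<in> E. v \<in> e} = (\<lambda>w. {v, w}) ` nbrs E v"
      unfolding nbrs_def by blast
    moreover have "inj_on (\<lambda>w. {v, w}) (nbrs E v)"
      by (auto simp: inj_on_def doubleton_eq_iff)
    ultimately show ?thesis
      by (simp add: card_image)
  qed
  then have "(\<Sum>v\<in>V. card (nbrs E v)) = (\<Sum>v\<in>V. card {e \<in> E. v \<in> e})"
    by simp
  also have "\<dots> = 2 * card E"
  proof (rule sum_multicount[OF fin], intro ballI)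
    fix e assume "e \<in> E"
    then have "\<exists>u\<in>V. \<exists>v\<in>V. e = {u, v} \<and> c u \<noteq> c v"
      using assms by (simp add: C5_saturated_def)
    then obtain u v where "u \<in> V" "v \<in> V" "e = {u, v}" "u \<noteq> v"
      by blast
    then have "{w \<in> V. w \<in> e} = {u, v}"
      by auto
    then show "card {w \<in> V. w \<in> e} = 2"
      using \<open>u \<noteq> v\<close> by simp
  qed
  finally show ?thesis .
qed

text \<open>Serves to identify the other neighbour of a vertex of degree 2, and the other colour
  when only two are present.\<close>

lemma card_2_unique:
  assumes "card A = 2" "a \<in> A" "b \<in> A" "c \<in> A" "a \<noteq> b" "a \<noteq> c"
  shows "b = c"
  using assms by (auto simp: card_2_iff)

section \<open>Deleting a leaf\<close>

text \<open>A leaf is never an inner vertex of a path, so four-edge paths between the remaining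
  vertices survive, and deletion creates no new ones.\<close>

lemma C5_saturated_remove_leaf:
  assumes good: "C5_saturated c V E" and x: "nbrs E x = {y}"
  shows "C5_saturated c (V - {x}) (E - {{x, y}})"
proof -
  have only: "w = y" if "{x, w} \<in> E" for w
    using that x by (auto simp: nbrs_def)
  have only': "w = y" if "{w, x} \<in> E" for w
    using only[of w] that by (simp only: insert_commute)
  have inner: "path4 (E - {{x, y}}) u v" if p4: "path4 E u v" and ends: "u \<noteq> x" "v \<noteq> x" for u v
  proof -
    obtain p q r where *: "distinct [u, p, q, r, v]"
      "{u, p} \<in> E" "{p, q} \<in> E" "{q, r} \<in> E" "{r, v} \<in> E"
      using p4 by (rule path4E)
    \<comment> \<open>An inner vertex has two distinct neighbours on the path, whereas
      \<open>x\<close> has only \<open>y\<close>.\<close>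
    have "x \<noteq> p" "x \<noteq> q" "x \<noteq> r"
      using * only'[of u] only[of q] only'[of p] only[of r] only'[of q] only[of v] by auto
    then show ?thesis
      using * ends by (intro path4I[of u p q r v]) (auto simp: doubleton_eq_iff)
  qed
  have outer: "path4 E u v" if "path4 (E - {{x, y}}) u v" for u v
    using that by (rule path4_mono) auto
  have proper: "\<exists>u\<in>V - {x}. \<exists>v\<in>V - {x}. e = {u, v} \<and> c u \<noteq> c v" if "e \<in> E - {{x, y}}" for e
  proof -
    have "\<exists>u\<in>V. \<exists>v\<in>V. e = {u, v} \<and> c u \<noteq> c v"
      using good that by (simp add: C5_saturated_def)
    then obtain u v where uv: "u \<in> V" "v \<in> V" "e = {u, v}" "c u \<noteq> c v"
      by blast
    moreover have "u \<noteq> x" "v \<noteq> x"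
      using only[of v] only'[of u] uv(3) that by (auto simp: insert_commute)
    ultimately show ?thesis
      by blast
  qed
  show ?thesis
    unfolding C5_saturated_def
  proof (intro conjI ballI allI impI)
    show "finite (V - {x})"
      using good by (simp add: C5_saturated_def)
  next
    fix u v assume "{u, v} \<in> E - {{x, y}}"
    then show "\<not> path4 (E - {{x, y}}) u v"
      using good outer unfolding C5_saturated_def by blast
  next
    fix u v assume uv: "u \<in> V - {x}" "v \<in> V - {x}" "c u \<noteq> c v"
    then have "{u, v} \<in> E \<or> path4 E u v"
      using good unfolding C5_saturated_def by simp
    then show "{u, v} \<in> E - {{x, y}} \<or> path4 (E - {{x, y}}) u v"
      using inner uv by (auto simp: doubleton_eq_iff)
  qed (rule proper)
qed

text \<open>Saturation supplies a four-edge path from \<open>x\<close> to the non-neighbour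
  \<open>u\<close>. Its first edge can only be \<open>{x, y}\<close>; the other three edges are
  returned.\<close>

lemma leaf_path3:
  assumes "C5_saturated c V E" "nbrs E x = {y}" "u \<in> V" "c u \<noteq> c x" "u \<noteq> y"
  obtains a b where "distinct [x, y, a, b, u]" "{y, a} \<in> E" "{a, b} \<in> E" "{b, u} \<in> E"
proof -
  have xy: "{x, y} \<in> E" and only: "\<And>w. {x, w} \<in> E \<Longrightarrow> w = y"
    using assms(2) by (auto simp: nbrs_def)
  have "x \<in> V"
    using C5_saturated_edge(1)[OF assms(1) xy] .
  then have "path4 E x u"
    using assms only[of u] unfolding C5_saturated_def by metis
  then obtain p a b where "distinct [x, p, a, b, u]"
    "{x, p} \<in> E" "{p, a} \<in> E" "{a, b} \<in> E" "{b, u} \<in> E"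
    by (rule path4E)
  then show thesis
    using only[of p] that[of a b] by simp
qed

text \<open>All neighbours of \<open>y\<close> other than \<open>x\<close> turn out to lie in the
  part of \<open>x\<close>, since otherwise \<open>y\<close> lies on a 4-cycle component that is too
  small for saturation. A path leaving \<open>y\<close> then closes to a 5-cycle.\<close>

lemma C5_saturated_leaf_not_regular:
  assumes good: "C5_saturated c V E" and x: "nbrs E x = {y}"
    and regular: "\<And>v. v \<in> V - {x} \<Longrightarrow> card (nbrs (E - {{x, y}}) v) = 2"
  shows False
proof -
  let ?E = "E - {{x, y}}"
  have xy: "{x, y} \<in> E"
    using x by (auto simp: nbrs_def)
  have only: "w = y" if "{x, w} \<in> E" for w
    using that x by (auto simp: nbrs_def)
  have y: "y \<in> V" "c x \<noteq> c y" "x \<noteq> y"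
    using C5_saturated_edge[OF good xy] by auto
  have edge: "a \<in> V" "b \<in> V" "c a \<noteq> c b" "{b, a} \<in> E" "a \<noteq> b" if "{a, b} \<in> E" for a b
    using C5_saturated_edge[OF good that] that by (auto simp: insert_commute)
  have uniq: "b = b'"
    \<comment> \<open>Away from \<open>x\<close> every vertex has degree 2, so one neighbour
      \<open>a\<close> determines the other.\<close>
    if "v \<noteq> x" "a \<noteq> x" "b \<noteq> x" "b' \<noteq> x" "{v, a} \<in> E" "{v, b} \<in> E" "{v, b'} \<in> E"
      "a \<noteq> b" "a \<noteq> b'" for v a b b'
    using that card_2_unique[OF regular[of v], of a b b'] edge(1)[of v a]
    by (auto simp: nbrs_def doubleton_eq_iff)
  have next_vertex: "\<exists>b. b \<noteq> a \<and> b \<noteq> x \<and> {v, b} \<in> E" if "v \<in> V" "v \<noteq> x" for v a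
  proof -
    have "\<exists>b\<in>nbrs ?E v. b \<noteq> a"
      using regular[of v] that by (auto simp: card_2_iff)
    then obtain b where b: "{v, b} \<in> ?E" "b \<noteq> a"
      by (auto simp: nbrs_def)
    moreover have "b \<noteq> x"
    proof
      assume "b = x"
      then have "v = y"
        using b(1) edge(4)[of v x] only[of v] by simp
      then show False
        using b(1) \<open>b = x\<close> by (simp add: insert_commute)
    qed
    ultimately show ?thesis
      by blast
  qed
  obtain p where p: "p \<noteq> x" "{y, p} \<in> E"
    using next_vertex[of y] y by blast
  have col: "c p = c x" if p: "p \<noteq> x" "{y, p} \<in> E" for p
  proof (rule ccontr)
    assume "c p \<noteq> c x"
    \<comment> \<open>With the edge \<open>{y, p}\<close> this path forms a 4-cycle
      \<open>y\<close>, \<open>q\<close>, \<open>q'\<close>, \<open>p\<close>. By regularity it is a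
      full component once \<open>x\<close> is removed, which \<open>Ny\<close>, \<open>Np\<close>,
      \<open>Nq\<close> and \<open>Nq'\<close> record.\<close>
    then obtain q q' where q: "distinct [x, y, q, q', p]" "{y, q} \<in> E" "{q, q'} \<in> E" "{q', p} \<in> E"
      using leaf_path3[OF good x edge(2)[OF p(2)]] edge(5)[OF p(2)] by metis
    have q': "q' \<in> V" "q' \<noteq> y" "q' \<noteq> x"
      using edge[OF q(4)] q(1) by auto
    have ny: "{y, q'} \<notin> E"
      using uniq[of y p q q'] q p by auto
    have Ny: "w = p \<or> w = q" if "{y, w} \<in> E" "w \<noteq> x" for w
      using uniq[of y p q w] q p that y by auto
    have Np: "w = y \<or> w = q'" if "{p, w} \<in> E" "w \<noteq> x" for w
      using uniq[of p y q' w] q p that y edge(4)[OF p(2)] edge(4)[OF q(4)] by auto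
    have Nq: "w = y \<or> w = q'" if "{q, w} \<in> E" "w \<noteq> x" for w
      using uniq[of q y q' w] q p that y edge(4)[OF q(2)] by auto
    have Nq': "w = p \<or> w = q" if "{q', w} \<in> E" "w \<noteq> x" for w
      using uniq[of q' p q w] q p that y edge(4)[OF q(3)] by auto
    show False
    \<comment> \<open>Either \<open>q'\<close> and \<open>y\<close> are in different parts and need
      a four-edge path inside a component of four vertices, or \<open>q'\<close> and
      \<open>x\<close> are, which needs a three-edge path between opposite vertices of the 4-cycle.
      Neither exists.\<close>
    proof (cases "c q' = c x")
      case True
      then have "path4 E y q'"
        using good q' y ny unfolding C5_saturated_def by metis
      then obtain a b d where "distinct [y, a, b, d, q']"
        "{y, a} \<in> E" "{a, b} \<in> E" "{b, d} \<in> E" "{d, q'} \<in> E"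
        by (rule path4E)
      moreover have "a \<noteq> x" "b \<noteq> x" "d \<noteq> x"
        using calculation only[of b] only[of d] only[of q'] q'(2) by auto
      ultimately show False
        using Ny Np Nq Nq' by (metis distinct_length_2_or_more)
    next
      case False
      then obtain a b where "distinct [x, y, a, b, q']" "{y, a} \<in> E" "{a, b} \<in> E" "{b, q'} \<in> E"
        using leaf_path3[OF good x q'(1)] q'(2) by metis
      then show False
        using Ny Np Nq Nq' by (metis distinct_length_2_or_more)
    qed
  qed
  obtain p' where p': "p' \<noteq> y" "p' \<noteq> x" "{p, p'} \<in> E"
    using next_vertex[of p y] p edge by blast
  have "c p' \<noteq> c x"
    using col[OF p] edge(3)[OF p'(3)] by metis
  then obtain a b where ab: "distinct [x, y, a, b, p']" "{y, a} \<in> E" "{a, b} \<in> E" "{b, p'} \<in> E"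
    using leaf_path3[OF good x edge(2)[OF p'(3)]] p'(1) by metis
  \<comment> \<open>By \<open>col\<close>, \<open>a\<close> and \<open>p\<close> share the colour of
    \<open>x\<close>, and \<open>b\<close> is adjacent to \<open>a\<close>. If \<open>a\<close> were
    \<open>p\<close>, then \<open>p\<close> would have the three neighbours \<open>y\<close>,
    \<open>b\<close> and \<open>p'\<close>. So \<open>y\<close>, \<open>a\<close>, \<open>b\<close>,
    \<open>p'\<close>, \<open>p\<close> is a path, closed by the edge \<open>{y, p}\<close>.\<close>
  have "b \<noteq> p"
    using col[of a] col[of p] edge(3)[OF ab(3)] ab p by auto
  moreover have "a \<noteq> p"
    using uniq[of p y b p'] ab p p' edge(4)[OF p(2)] y by auto
  ultimately have "path4 E y p"
    using ab p' edge(4,5)[OF p'(3)] edge(5)[OF p(2)]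
    by (intro path4I[of y a b p' p]) auto
  then show False
    using good p unfolding C5_saturated_def by blast
qed

text \<open>If \<open>x\<close> were alone in its part, the rest would be two-coloured, and colours
  would alternate along the path \<open>y\<close>, \<open>a\<close>, \<open>b\<close>,
  \<open>u\<close> to any further vertex \<open>u\<close>. Hence no such \<open>u\<close> has the
  colour of \<open>y\<close>, yet \<open>b\<close> is one that does.\<close>

lemma C5_saturated_remove_leaf_colours:
  assumes good: "C5_saturated c V E" and x: "nbrs E x = {y}" and col: "card (c ` V) = 3"
  shows "card (c ` (V - {x})) = 3"
proof -
  let ?C = "c ` (V - {x})"
  have xy: "{x, y} \<in> E"
    using x by (auto simp: nbrs_def)
  have xV: "x \<in> V" and y: "y \<in> V" "y \<noteq> x"
    using C5_saturated_edge[OF good xy] by auto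
  have C: "c ` V = insert (c x) ?C"
    using xV by blast
  have fin: "finite ?C"
    using good by (simp add: C5_saturated_def)
  have "c x \<in> ?C"
  proof (rule ccontr)
    assume new: "c x \<notin> ?C"
    then have card: "card ?C = 2"
      using col fin unfolding C by simp
    have other: "c u \<noteq> c y \<and> (\<exists>b\<in>V. b \<noteq> x \<and> b \<noteq> y \<and> c b = c y)"
      if u: "u \<in> V" "u \<noteq> x" "u \<noteq> y" for u
    proof -
      have "c u \<noteq> c x"
        using new u by (metis DiffI imageI singletonD)
      then obtain a b where ab: "distinct [x, y, a, b, u]" "{y, a} \<in> E" "{a, b} \<in> E" "{b, u} \<in> E"
        by (rule leaf_path3[OF good x u(1) _ u(3)])
      have "a \<in> V" "b \<in> V"
        using C5_saturated_edge[OF good ab(3)] by auto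
      then have mem: "c y \<in> ?C" "c a \<in> ?C" "c b \<in> ?C"
        using ab(1) y by auto
      have "c a \<noteq> c y" "c a \<noteq> c b" "c b \<noteq> c u"
        using C5_saturated_edge(3)[OF good ab(2)] C5_saturated_edge(3)[OF good ab(3)]
          C5_saturated_edge(3)[OF good ab(4)]
        by auto
      then show ?thesis
        using card_2_unique[OF card mem(2,1,3)] ab(1) \<open>b \<in> V\<close> by auto
    qed
    have "\<not> ?C \<subseteq> {c y}"
      using card card_mono[of "{c y}" ?C] by auto
    then obtain u where "u \<in> V" "u \<noteq> x" "u \<noteq> y"
      by auto
    then show False
      using other by blast
  qed
  then show ?thesis
    using col C by (simp add: insert_absorb)
qed

section \<open>Lower bounds on the number of edges\<close>

text \<open>Induction on the number of vertices. Removing a leaf lowers both counts by one, so the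
  rest would be 2-regular, which \<open>C5_saturated_leaf_not_regular\<close> forbids. Thus all
  degrees are at least 2 and the handshake identity leaves no slack.\<close>

lemma C5_saturated_two_regular:
  assumes "C5_saturated c V E" "card (c ` V) = 3" "card E \<le> card V" "v \<in> V"
  shows "card (nbrs E v) = 2"
  using assms
proof (induction "card V" arbitrary: V E v rule: less_induct)
  case less
  note good = less.prems(1)
  have fin: "finite V" "finite E"
    using good finite_good_edges by (auto simp: C5_saturated_def)
  have deg: "2 \<le> card (nbrs E x)" if x: "x \<in> V" for x
  proof (rule ccontr)
    assume "\<not> ?thesis"
    then consider "card (nbrs E x) = 0" | "card (nbrs E x) = 1"
      by linarith
    then show False
    proof cases
      case 1
      \<comment> \<open>A vertex of another part exists and would have to be adjacent to
        \<open>x\<close> or joined to it by a path; both need an edge at \<open>x\<close>.\<close>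
      then have iso: "{x, w} \<notin> E" for w
        using finite_nbrs[OF good, of x] by (auto simp: nbrs_def)
      have "\<not> c ` V \<subseteq> {c x}"
        using less.prems(2) card_mono[of "{c x}" "c ` V"] by auto
      then obtain w where "w \<in> V" "c w \<noteq> c x"
        by auto
      then have "path4 E x w"
        using good x iso[of w] unfolding C5_saturated_def by metis
      then show False
        by (rule path4E) (use iso in blast)
    next
      case 2
      then obtain y where y: "nbrs E x = {y}"
        by (auto simp: card_1_singleton_iff)
      have "{x, y} \<in> E"
        using y by (auto simp: nbrs_def)
      then have "card (E - {{x, y}}) \<le> card (V - {x})"
        using less.prems(3) fin x by simp
      moreover have "card (V - {x}) < card V"
        using fin x by (intro card_Diff1_less)
      ultimately have "card (nbrs (E - {{x, y}}) w) = 2" if "w \<in> V - {x}" for w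
        using less.hyps C5_saturated_remove_leaf[OF good y]
          C5_saturated_remove_leaf_colours[OF good y less.prems(2)] that
        by blast
      then show False
        by (rule C5_saturated_leaf_not_regular[OF good y])
    qed
  qed
  \<comment> \<open>The degree sum is at most \<open>2 * card V\<close>, while each term is at least
    2, so each term equals 2.\<close>
  have "(\<Sum>v\<in>V. card (nbrs E v)) \<le> (\<Sum>v\<in>V. 2)"
    using sum_card_nbrs[OF good] less.prems(3) by simp
  then have "(\<Sum>v\<in>V. 2) = (\<Sum>v\<in>V. card (nbrs E v))"
    using sum_mono[of V "\<lambda>_. 2" "\<lambda>v. card (nbrs E v)"] deg by (intro antisym) auto
  then show ?case
    using sum_mono_inv[of "\<lambda>_. 2" V "\<lambda>v. card (nbrs E v)" v] deg less.prems(4) fin by simp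
qed

text \<open>With fewer edges than vertices the graph would be 2-regular, and then the two numbers
  agree.\<close>

lemma C5_saturated_card_le_edges:
  assumes "C5_saturated c V E" "card (c ` V) = 3"
  shows "card V \<le> card E"
proof (rule ccontr)
  assume less: "\<not> ?thesis"
  then have "(\<Sum>v\<in>V. card (nbrs E v)) = (\<Sum>v\<in>V. 2)"
    using C5_saturated_two_regular[OF assms] by (intro sum.cong) auto
  then show False
    using sum_card_nbrs[OF assms(1)] less by simp
qed

text \<open>In a 2-regular graph a walk without backtracking is determined by its first edge, for
  which there are two choices.\<close>

lemma card_path4_regular:
  assumes good: "C5_saturated c V E" and regular: "\<And>v. v \<in> V \<Longrightarrow> card (nbrs E v) = 2" and v: "v \<in> V"
  shows "finite {w. path4 E v w}" "card {w. path4 E v w} \<le> 2"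
proof -
  \<comment> \<open>The continuation of a walk that reaches \<open>b\<close> from \<open>a\<close>.
    The choice is unique when \<open>{a, b}\<close> is an edge; \<open>g\<close> iterates it to find
    the endpoint of the path whose first step is \<open>x\<close>.\<close>
  define nx where "nx a b = (SOME d. {b, d} \<in> E \<and> d \<noteq> a)" for a b
  have nx: "nx a b = d" if "{a, b} \<in> E" "{b, d} \<in> E" "d \<noteq> a" for a b d
    unfolding nx_def
  proof (rule some_equality)
    have "b \<in> V" "{b, a} \<in> E"
      using C5_saturated_edge(2)[OF good that(1)] that(1) by (auto simp: insert_commute)
    then show "d' = d" if "{b, d'} \<in> E \<and> d' \<noteq> a" for d'
      using that card_2_unique[OF regular[of b], of a d' d] \<open>{b, d} \<in> E\<close> \<open>d \<noteq> a\<close>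
      by (auto simp: nbrs_def)
  qed (use that in simp)
  define g where "g x = (let y = nx v x; z = nx x y in nx y z)" for x
  have sub: "{w. path4 E v w} \<subseteq> g ` nbrs E v"
  proof
    fix w assume "w \<in> {w. path4 E v w}"
    then have "path4 E v w"
      by simp
    then obtain x y z where *: "distinct [v, x, y, z, w]"
      "{v, x} \<in> E" "{x, y} \<in> E" "{y, z} \<in> E" "{z, w} \<in> E"
      by (rule path4E)
    have "nx v x = y" "nx x y = z" "nx y z = w"
      using nx[OF *(2,3)] nx[OF *(3,4)] nx[OF *(4,5)] *(1) by auto
    then have "g x = w"
      by (simp add: g_def)
    then show "w \<in> g ` nbrs E v"
      using *(2) by (auto simp: nbrs_def)
  qed
  have fin: "finite (g ` nbrs E v)"
    using finite_nbrs[OF good] by simp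
  then show "finite {w. path4 E v w}"
    using sub by (rule rev_finite_subset)
  have "card {w. path4 E v w} \<le> card (g ` nbrs E v)"
    using fin sub by (rule card_mono)
  also have "\<dots> \<le> 2"
    using card_image_le[OF finite_nbrs[OF good], of g v] regular[OF v] by simp
  finally show "card {w. path4 E v w} \<le> 2" .
qed

text \<open>Outside its part a vertex sees at most two neighbours and two ends of four-edge paths.
  Summing this bound of 4 over three parts counts each vertex twice, so
  \<open>2 * card V \<le> 12\<close>.\<close>

lemma C5_saturated_regular_card_le_6:
  assumes good: "C5_saturated c V E" and regular: "\<And>v. v \<in> V \<Longrightarrow> card (nbrs E v) = 2"
    and col: "card (c ` V) = 3"
  shows "card V \<le> 6"
proof -
  have fin: "finite V"
    using good by (simp add: C5_saturated_def)
  have "card {w \<in> V. c w \<noteq> c v} \<le> 4" if v: "v \<in> V" for v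
  proof -
    have "{w \<in> V. c w \<noteq> c v} \<subseteq> nbrs E v \<union> {w. path4 E v w}"
      using good v unfolding C5_saturated_def nbrs_def by force
    then have "card {w \<in> V. c w \<noteq> c v} \<le> card (nbrs E v \<union> {w. path4 E v w})"
      using card_path4_regular(1)[OF good regular v] finite_nbrs[OF good]
      by (intro card_mono) auto
    also have "\<dots> \<le> card (nbrs E v) + card {w. path4 E v w}"
      by (rule card_Un_le)
    also have "\<dots> \<le> 4"
      using card_path4_regular(2)[OF good regular v] regular[OF v] by simp
    finally show ?thesis .
  qed
  then have "(\<Sum>k\<in>c ` V. card {w \<in> V. c w \<noteq> k}) \<le> (\<Sum>k\<in>c ` V. 4)"
    by (intro sum_mono) auto
  also have "\<dots> = 12"
    using col by simp
  also have "(\<Sum>k\<in>c ` V. card {w \<in> V. c w \<noteq> k}) = 2 * card V"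
  proof (rule sum_multicount)
    have "{k \<in> c ` V. c w \<noteq> k} = c ` V - {c w}" for w
      by auto
    then show "\<forall>w\<in>V. card {k \<in> c ` V. c w \<noteq> k} = 2"
      using col fin by simp
  qed (use fin in simp_all)
  finally show ?thesis
    by simp
qed

lemma C5_saturated_card_less_edges:
  assumes "C5_saturated c V E" "card (c ` V) = 3" "6 < card V"
  shows "card V < card E"
  using C5_saturated_two_regular[OF assms(1,2)] C5_saturated_regular_card_le_6[OF assms(1) _ assms(2)] assms(3)
  by (meson leD leI)

section \<open>Saturated graphs attaining the bounds\<close>

text \<open>The vertex set of a 5-cycle has exactly five elements and minimum degree at least 2
  inside itself. Both constructions are shown to be free of 5-cycles by excluding such a
  set.\<close>

lemma closed_path4_core:
  assumes "{u, v} \<in> E" "path4 E u v"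
  obtains S where "card S = 5"
    "\<And>a. a \<in> S \<Longrightarrow> \<exists>b\<in>S. \<exists>d\<in>S. b \<noteq> d \<and> {a, b} \<in> E \<and> {a, d} \<in> E"
proof -
  obtain x y z where *: "distinct [u, x, y, z, v]"
    "{u, x} \<in> E" "{x, y} \<in> E" "{y, z} \<in> E" "{z, v} \<in> E"
    using assms(2) by (rule path4E)
  have r: "{v, u} \<in> E" "{x, u} \<in> E" "{y, x} \<in> E" "{z, y} \<in> E" "{v, z} \<in> E"
    using * assms(1) by (simp_all only: insert_commute)
  show thesis
  proof (rule that[of "{u, x, y, z, v}"])
    show "card {u, x, y, z, v} = 5"
      using *(1) by simp
  next
    fix a assume "a \<in> {u, x, y, z, v}"
    then consider "a = u" | "a = x" | "a = y" | "a = z" | "a = v"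
      by auto
    then show "\<exists>b\<in>{u, x, y, z, v}. \<exists>d\<in>{u, x, y, z, v}. b \<noteq> d \<and> {a, b} \<in> E \<and> {a, d} \<in> E"
      by cases (use * r assms(1) in auto)
  qed
qed

text \<open>The cycle visits the parts in the order 0, 1, 2, 0, 1, 2, so opposite vertices share a
  part and need not be joined.\<close>

definition hexagon :: "(nat \<times> nat) set set" where
  "hexagon = {{(0, 0), (1, 0)}, {(1, 0), (2, 0)}, {(2, 0), (0, 1)},
              {(0, 1), (1, 1)}, {(1, 1), (2, 1)}, {(2, 1), (0, 0)}}"

lemma C5_saturated_hexagon: "C5_saturated fst ({..<3} \<times> {..<2}) hexagon"
proof -
  have V: "{..<3} \<times> {..<2} = {(0, 0), (0, 1), (1, 0), (1, 1), (2, 0), (2, 1 :: nat) :: nat \<times> nat}"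
    by (auto simp: numeral_3_eq_3 numeral_2_eq_2 less_Suc_eq)
  have closed: "\<not> path4 hexagon u v" if "{u, v} \<in> hexagon" for u v
  proof
    assume "path4 hexagon u v"
    with that obtain S where card: "card S = 5"
      and S: "\<And>a. a \<in> S \<Longrightarrow> \<exists>b\<in>S. \<exists>d\<in>S. b \<noteq> d \<and> {a, b} \<in> hexagon \<and> {a, d} \<in> hexagon"
      by (rule closed_path4_core) blast
    \<comment> \<open>A vertex of the hexagon has only two neighbours, so both belong to
      \<open>S\<close>. Going round the cycle yields six elements of \<open>S\<close>.\<close>
    have step: "(0, 0) \<in> S \<Longrightarrow> (1, 0) \<in> S" "(1, 0) \<in> S \<Longrightarrow> (2, 0) \<in> S"
      "(2, 0) \<in> S \<Longrightarrow> (0, 1) \<in> S" "(0, 1) \<in> S \<Longrightarrow> (1, 1) \<in> S"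
      "(1, 1) \<in> S \<Longrightarrow> (2, 1) \<in> S" "(2, 1) \<in> S \<Longrightarrow> (0, 0) \<in> S"
      by (drule S, auto simp: hexagon_def doubleton_eq_iff)+
    obtain a where a: "a \<in> S"
      using card by (cases "S = {}") auto
    have "a \<in> {..<3} \<times> {..<2}"
      unfolding V using S[OF a] by (auto simp: hexagon_def doubleton_eq_iff)
    then have "{..<3} \<times> {..<2} \<subseteq> S"
      using a step unfolding V by auto
    moreover have "finite S"
      using card by (intro card_ge_0_finite) simp
    ultimately show False
      using card card_mono[of S "{..<3} \<times> {..<2}"] by simp
  qed
  have p: "path4 hexagon u v"
    if "{u, x} \<in> hexagon" "{x, y} \<in> hexagon" "{y, z} \<in> hexagon" "{z, v} \<in> hexagon"
      "distinct [u, x, y, z, v]" for u x y z v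
    using that by (intro path4I[of u x y z v])
  \<comment> \<open>These are the six pairs at distance 2; the complementary arc has four
    edges.\<close>
  have far: "path4 hexagon (0, 0) (1, 1)" "path4 hexagon (1, 0) (2, 1)" "path4 hexagon (2, 0) (0, 0)"
     "path4 hexagon (0, 1) (1, 0)" "path4 hexagon (1, 1) (2, 0)" "path4 hexagon (2, 1) (0, 1)"
    using p[of "(0, 0)" "(1, 0)" "(2, 0)" "(0, 1)" "(1, 1)"]
      p[of "(1, 0)" "(2, 0)" "(0, 1)" "(1, 1)" "(2, 1)"]
      p[of "(2, 0)" "(0, 1)" "(1, 1)" "(2, 1)" "(0, 0)"]
      p[of "(0, 1)" "(1, 1)" "(2, 1)" "(0, 0)" "(1, 0)"]
      p[of "(1, 1)" "(2, 1)" "(0, 0)" "(1, 0)" "(2, 0)"]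
      p[of "(2, 1)" "(0, 0)" "(1, 0)" "(2, 0)" "(0, 1)"]
    by (simp_all add: hexagon_def)
  have near: "{(0, 0), (1, 0)} \<in> hexagon" "{(1, 0), (2, 0)} \<in> hexagon"
    "{(2, 0), (0, 1)} \<in> hexagon" "{(0, 1), (1, 1)} \<in> hexagon" "{(1, 1), (2, 1)} \<in> hexagon"
    "{(2, 1), (0, 0)} \<in> hexagon"
    by (simp_all add: hexagon_def)
  have rev: "{v, u} \<in> hexagon" if "{u, v} \<in> hexagon" for u v
    using that by (simp only: insert_commute[of v u "{}"])
  have cross: "\<forall>u\<in>{..<3} \<times> {..<2}. \<forall>v\<in>{..<3} \<times> {..<2}. fst u \<noteq> fst v \<longrightarrow>
      {u, v} \<in> hexagon \<or> path4 hexagon u v"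
    unfolding V using near near[THEN rev] far far[THEN path4_sym] by simp
  have "\<exists>u\<in>{..<3} \<times> {..<2}. \<exists>v\<in>{..<3} \<times> {..<2}. e = {u, v} \<and> fst u \<noteq> fst v"
    if "e \<in> hexagon" for e
    using that unfolding V hexagon_def by (elim insertE emptyE) simp_all
  then show ?thesis
    unfolding C5_saturated_def using closed cross by simp
qed

text \<open>
  The diamond on \<open>(0, 0)\<close>, \<open>(1, 0)\<close>, \<open>(2, 0)\<close>, \<open>(2, 1)\<close> lacks the edge inside part 2; \<open>(0, 1)\<close> hangs
  from \<open>(2, 0)\<close>. All remaining vertices of parts 0, 1, 2 are leaves at \<open>(1, 0)\<close>, \<open>(0, 0)\<close>, \<open>(0, 1)\<close>,
  respectively.
\<close>

definition diamond_arcs :: "nat \<Rightarrow> ((nat \<times> nat) \<times> (nat \<times> nat)) set" where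
  "diamond_arcs n =
     {((0, 0), (1, 0)), ((0, 0), (2, 0)), ((0, 0), (2, 1)), ((1, 0), (2, 0)), ((1, 0), (2, 1)),
      ((2, 0), (0, 1))} \<union>
     {(1, 0)} \<times> ({0} \<times> {2..<n}) \<union> {(0, 0)} \<times> ({1} \<times> {1..<n}) \<union> {(0, 1)} \<times> ({2} \<times> {2..<n})"

text \<open>Listing every edge as an ordered pair reduces adjacency to membership in a union of
  explicit products.\<close>

definition diamond_edges :: "nat \<Rightarrow> (nat \<times> nat) set set" where
  "diamond_edges n = (\<lambda>(u, v). {u, v}) ` diamond_arcs n"

lemma diamond_edges_iff:
  "{u, v} \<in> diamond_edges n \<longleftrightarrow> (u, v) \<in> diamond_arcs n \<or> (v, u) \<in> diamond_arcs n"
  by (auto simp: diamond_edges_def image_iff doubleton_eq_iff)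

lemma card_diamond_edges:
  assumes "2 \<le> n"
  shows "card (diamond_edges n) \<le> 3 * n + 1"
proof -
  let ?A = "{((0, 0), (1, 0)), ((0, 0), (2, 0)), ((0, 0), (2, 1)), ((1, 0), (2, 0)),
    ((1, 0), (2, 1)), ((2, 0), (0, 1 :: nat) :: nat \<times> nat) :: (nat \<times> nat) \<times> (nat \<times> nat)}"
  let ?B = "{(1, 0)} \<times> ({0} \<times> {2..<n}) :: ((nat \<times> nat) \<times> (nat \<times> nat)) set"
  let ?C = "{(0, 0)} \<times> ({1} \<times> {1..<n}) :: ((nat \<times> nat) \<times> (nat \<times> nat)) set"
  let ?D = "{(0, 1)} \<times> ({2} \<times> {2..<n}) :: ((nat \<times> nat) \<times> (nat \<times> nat)) set"
  have "finite (diamond_arcs n)"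
    by (simp add: diamond_arcs_def)
  then have "card (diamond_edges n) \<le> card (diamond_arcs n)"
    unfolding diamond_edges_def by (rule card_image_le)
  also have "\<dots> \<le> card ?A + card ?B + card ?C + card ?D"
    unfolding diamond_arcs_def by (meson card_Un_le add_mono order_trans order_refl)
  \<comment> \<open>The count is \<open>6 + (n - 2) + (n - 1) + (n - 2)\<close>;
    \<open>2 \<le> n\<close> keeps the subtractions exact.\<close>
  also have "\<dots> = 3 * n + 1"
    using assms by simp
  finally show ?thesis .
qed

lemma C5_saturated_diamond_edges:
  assumes n: "2 \<le> n"
  shows "C5_saturated fst ({..<3} \<times> {..<n}) (diamond_edges n)"
proof -
  let ?E = "diamond_edges n"
  note adj = diamond_edges_iff diamond_arcs_def
  have proper: "\<exists>u\<in>{..<3} \<times> {..<n}. \<exists>v\<in>{..<3} \<times> {..<n}. e = {u, v} \<and> fst u \<noteq> fst v"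
    if e: "e \<in> ?E" for e
  proof -
    obtain u v where "e = {u, v}" "(u, v) \<in> diamond_arcs n"
      using e by (auto simp: diamond_edges_def)
    moreover from this(2) have "u \<in> {..<3} \<times> {..<n}" "v \<in> {..<3} \<times> {..<n}" "fst u \<noteq> fst v"
      using n by (auto simp: diamond_arcs_def)
    ultimately show ?thesis
      by blast
  qed
  have closed: "\<not> path4 ?E u v" if "{u, v} \<in> ?E" for u v
  proof
    assume "path4 ?E u v"
    with that obtain S where card: "card S = 5"
      and S: "\<And>a. a \<in> S \<Longrightarrow> \<exists>b\<in>S. \<exists>d\<in>S. b \<noteq> d \<and> {a, b} \<in> ?E \<and> {a, d} \<in> ?E"
      by (rule closed_path4_core) blast
    \<comment> \<open>All other vertices are leaves. Among the five listed, \<open>(0, 1)\<close> is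
      adjacent only to \<open>(2, 0)\<close>, so it drops out as well and four vertices
      remain.\<close>
    have core: "a \<in> {(0, 0), (1, 0), (2, 0), (2, 1), (0, 1)}" if "a \<in> S" for a
      using S[OF that] by (auto simp: adj)
    moreover have "(0, 1) \<notin> S"
    proof
      assume "(0, 1) \<in> S"
      then obtain b d where "b \<in> S" "d \<in> S" "b \<noteq> d" "{(0, 1), b} \<in> ?E" "{(0, 1), d} \<in> ?E"
        using S by blast
      then show False
        using core[of b] core[of d] by (auto simp: adj)
    qed
    ultimately have "S \<subseteq> {(0, 0), (1, 0), (2, 0), (2, 1)}"
      by blast
    then show False
      using card card_mono[of "{(0, 0), (1, 0), (2, 0), (2, 1 :: nat) :: nat \<times> nat}" S] by simp
  qed
  have p: "path4 ?E u v"
    if "{u, x} \<in> ?E" "{x, y} \<in> ?E" "{y, z} \<in> ?E" "{z, v} \<in> ?E" "distinct [u, x, y, z, v]"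
    for u x y z v
    using that by (intro path4I[of u x y z v])
  \<comment> \<open>The role of a vertex depends only on whether its index is 0, 1 or at least 2 (in
    part 1: 0 or at least 1). Each nonadjacent combination gets an explicit path; the cases left to
    the closing \<open>qed\<close> are edges.\<close>
  have cross: "{u, v} \<in> ?E \<or> path4 ?E u v"
    if uv: "u \<in> {..<3} \<times> {..<n}" "v \<in> {..<3} \<times> {..<n}" "fst u < fst v" for u v
  proof -
    obtain i a j b where u: "u = (i, a)" and v: "v = (j, b)"
      by (metis surj_pair)
    have ab: "a < n" "b < n"
      using uv u v by auto
    consider "i = 0" "j = 1" | "i = 0" "j = 2" | "i = 1" "j = 2"
      using uv u v by force
    then show ?thesis
    proof cases
      case 1
      consider "a = 0" | "a = 1" "b = 0" | "a = 1" "b \<ge> 1" | "a \<ge> 2" "b = 0" | "a \<ge> 2" "b \<ge> 1"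
        by linarith
      then show ?thesis
      proof cases
        case 2
        then show ?thesis
          using p[of u "(2, 0)" "(0, 0)" "(2, 1)" v] \<open>i = 0\<close> \<open>j = 1\<close> u v by (simp add: adj)
      next
        case 3
        then show ?thesis
          using p[of u "(2, 0)" "(1, 0)" "(0, 0)" v] \<open>i = 0\<close> \<open>j = 1\<close> u v ab by (simp add: adj)
      next
        case 5
        then show ?thesis
          using p[of u "(1, 0)" "(2, 0)" "(0, 0)" v] \<open>i = 0\<close> \<open>j = 1\<close> u v ab by (simp add: adj)
      qed (use \<open>i = 0\<close> \<open>j = 1\<close> u v ab in \<open>auto simp: adj\<close>)
    next
      case 2
      consider "a = 0" "b \<le> 1" | "a = 0" "b \<ge> 2" | "a = 1" "b = 0" | "a = 1" "b = 1"
        | "a = 1" "b \<ge> 2" | "a \<ge> 2" "b = 0" | "a \<ge> 2" "b = 1" | "a \<ge> 2" "b \<ge> 2"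
        by linarith
      then show ?thesis
      proof cases
        case 2
        then show ?thesis
          using p[of u "(1, 0)" "(2, 0)" "(0, 1)" v] \<open>i = 0\<close> \<open>j = 2\<close> u v ab by (simp add: adj)
      next
        case 4
        then show ?thesis
          using p[of u "(2, 0)" "(0, 0)" "(1, 0)" v] \<open>i = 0\<close> \<open>j = 2\<close> u v ab by (simp add: adj)
      next
        case 6
        then show ?thesis
          using p[of u "(1, 0)" "(2, 1)" "(0, 0)" v] \<open>i = 0\<close> \<open>j = 2\<close> u v ab by (simp add: adj)
      next
        case 7
        then show ?thesis
          using p[of u "(1, 0)" "(2, 0)" "(0, 0)" v] \<open>i = 0\<close> \<open>j = 2\<close> u v ab by (simp add: adj)
      next
        case 8
        then show ?thesis
          using p[of u "(1, 0)" "(2, 0)" "(0, 1)" v] \<open>i = 0\<close> \<open>j = 2\<close> u v ab by (simp add: adj)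
      qed (use \<open>i = 0\<close> \<open>j = 2\<close> u v ab in \<open>auto simp: adj\<close>)
    next
      case 3
      consider "a = 0" "b \<le> 1" | "a = 0" "b \<ge> 2" | "a \<ge> 1" "b = 0" | "a \<ge> 1" "b = 1"
        | "a \<ge> 1" "b \<ge> 2"
        by linarith
      then show ?thesis
      proof cases
        case 2
        then show ?thesis
          using p[of u "(0, 0)" "(2, 0)" "(0, 1)" v] \<open>i = 1\<close> \<open>j = 2\<close> u v ab by (simp add: adj)
      next
        case 3
        then show ?thesis
          using p[of u "(0, 0)" "(2, 1)" "(1, 0)" v] \<open>i = 1\<close> \<open>j = 2\<close> u v ab by (simp add: adj)
      next
        case 4
        then show ?thesis
          using p[of u "(0, 0)" "(2, 0)" "(1, 0)" v] \<open>i = 1\<close> \<open>j = 2\<close> u v ab by (simp add: adj)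
      next
        case 5
        then show ?thesis
          using p[of u "(0, 0)" "(2, 0)" "(0, 1)" v] \<open>i = 1\<close> \<open>j = 2\<close> u v ab by (simp add: adj)
      qed (use \<open>i = 1\<close> \<open>j = 2\<close> u v ab in \<open>auto simp: adj\<close>)
    qed
  qed
  have cross': "{u, v} \<in> ?E \<or> path4 ?E u v"
    if "u \<in> {..<3} \<times> {..<n}" "v \<in> {..<3} \<times> {..<n}" "fst u \<noteq> fst v" for u v
  proof (cases "fst u < fst v")
    case True
    then show ?thesis
      using cross that by blast
  next
    case False
    then have "{v, u} \<in> ?E \<or> path4 ?E v u"
      using that by (intro cross) auto
    then show ?thesis
      using path4_sym[of ?E v u] by (auto simp: insert_commute)
  qed
  show ?thesis
    unfolding C5_saturated_def using proper closed cross' by blast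
qed

theorem theorem1p6:
  shows "sat_number (complete_multipartite 3 2) (cycle_graph 5) = 6 \<and>
    (\<forall>n\<ge>3. sat_number (complete_multipartite 3 n) (cycle_graph 5) = 3 * n + 1)"
proof (intro conjI allI impI)
  \<comment> \<open>All three parts are nonempty, as the lower bounds require.\<close>
  have colours: "card (fst ` ({..<3 :: nat} \<times> {..<n :: nat})) = 3" if "0 < n" for n
    using that by (simp add: fst_image_times lessThan_empty_iff)
  show "sat_number (complete_multipartite 3 2) (cycle_graph 5) = 6"
  proof (rule sat_number_complete_multipartite_C5_eq)
    show "card hexagon \<le> 6"
      unfolding hexagon_def by (rule card_insert_le_m1 | simp)+
    show "6 \<le> card E" if "C5_saturated fst ({..<3 :: nat} \<times> {..<2 :: nat}) E" for E
      using C5_saturated_card_le_edges[OF that colours] by simp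
  qed (rule C5_saturated_hexagon)
  show "sat_number (complete_multipartite 3 n) (cycle_graph 5) = 3 * n + 1" if n: "3 \<le> n" for n
  proof (rule sat_number_complete_multipartite_C5_eq)
    show "card (diamond_edges n) \<le> 3 * n + 1"
      using n by (intro card_diamond_edges) simp
    show "C5_saturated fst ({..<3} \<times> {..<n}) (diamond_edges n)"
      using n by (intro C5_saturated_diamond_edges) simp
    \<comment> \<open>Here \<open>3 * n\<close> exceeds 6, which rules out the 2-regular case and
      makes the lower bound strict.\<close>
    show "3 * n + 1 \<le> card E" if "C5_saturated fst ({..<3 :: nat} \<times> {..<n :: nat}) E" for E
      using C5_saturated_card_less_edges[OF that colours] n by simp
  qed
qed

end
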